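(* Under the regular simple real critical eigenvalue assumption described in the context, the fluctuation term $\Phi(\alpha)=\frac{1}{N-1}\operatorname{Tr}\big(P\,C(\alpha)\big)$ satisfies, as $\alpha\to\alpha_{\mathrm c}^-$, $$\Phi(\alpha)=\frac{\sigma_{\mathrm{eff}}^2}{2\lambda_1}\,\frac{1-\rho}{N-1}+O(1),$$ where $\sigma_{\mathrm{eff}}^2=\boldsymbol{w}^\top BB^\top\boldsymbol{w}$ and $\rho=(\boldsymbol{1}^\top\boldsymbol{v})^2/N$.
   Context: Setting. $N\ge2$. Consider the It\^o SDE $\mathrm d\boldsymbol{x}=F(\boldsymbol{x};\alpha)\,\mathrm dt+B\,\mathrm d\boldsymbol{W}$ in $\mathbb{R}^N$, with $B\in\mathbb{R}^{N\times m}$ constant, $\boldsymbol{W}$ an $m$-dimensional standard Wiener process, and $F$ sufficiently smooth in $(\boldsymbol{x},\alpha)$ ($C^2$ in a neighborhood of the equilibrium branch, including its endpoint at $\alpha_{\mathrm c}$, suffices). $\boldsymbol{x}^*(\alpha)$ is a branch of equilibria, $F(\boldsymbol{x}^*(\alpha);\alpha)=\boldsymbol{0}$, asymptotically stable for $\alpha<\alpha_{\mathrm c}$, and $M(\alpha)=-\frac{\partial F}{\partial\boldsymbol{x}}\big|_{\boldsymbol{x}=\boldsymbol{x}^*(\alpha)}$. $C=C(\alpha)$ is the stationary covariance of the linearized process $\mathrm d\boldsymbol{z}=-M\boldsymbol{z}\,\mathrm dt+B\,\mathrm d\boldsymbol{W}$, i.e. the solution of $MC+CM^\top=BB^\top$.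 Regular simple real critical eigenvalue assumption. As $\alpha\to\alpha_{\mathrm c}^-$, $\boldsymbol{x}^*(\alpha)$ has a finite limit. For $\alpha<\alpha_{\mathrm c}$ close to $\alpha_{\mathrm c}$, $M(\alpha)$ is diagonalizable over $\mathbb{C}$ with all eigenvalues of positive real part; the eigenvalue $\lambda_1(\alpha)$ of smallest real part is real and simple, $\lambda_1(\alpha)>0$, $\lambda_1(\alpha)\to0$, and $\operatorname{Re}\lambda_k(\alpha)\ge\delta>0$ for $k=2,\dots,N$, with $\delta$ independent of $\alpha$. Real right and left eigenvectors $\boldsymbol{v}(\alpha),\boldsymbol{w}(\alpha)$ are chosen with $M\boldsymbol{v}=\lambda_1\boldsymbol{v}$, $\boldsymbol{w}^\top M=\lambda_1\boldsymbol{w}^\top$, $\|\boldsymbol{v}\|_2=1$, $\boldsymbol{w}^\top\boldsymbol{v}=1$, and they have finite limits $\boldsymbol{v}_{\mathrm c},\boldsymbol{w}_{\mathrm c}$ as $\alpha\to\alpha_{\mathrm c}^-$. Notation: $P=I-\frac1N\boldsymbol{1}\boldsymbol{1}^\top$, with $\boldsymbol{1}$ the all-ones vector. *)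

theory Defs
  imports
    "HOL-Analysis.Analysis"
    "HOL-Computational_Algebra.Polynomial"
    "HOL-Library.Landau_Symbols"
begin

definition C2_on :: "('a::real_normed_vector \<Rightarrow> 'b::real_normed_vector) \<Rightarrow> 'a set \<Rightarrow> bool" where
  "C2_on f U \<longleftrightarrow>
     (\<exists>(f' :: 'a \<Rightarrow> 'a \<Rightarrow>\<^sub>L 'b) (f'' :: 'a \<Rightarrow> 'a \<Rightarrow>\<^sub>L 'a \<Rightarrow>\<^sub>L 'b).
        (\<forall>x\<in>U. (f has_derivative blinfun_apply (f' x)) (at x)) \<and>
        (\<forall>x\<in>U. (f' has_derivative blinfun_apply (f'' x)) (at x)) \<and>
        continuous_on U f'')"

definition solves_on :: "('a::real_normed_vector \<Rightarrow> 'a) \<Rightarrow> (real \<Rightarrow> 'a) \<Rightarrow> real set \<Rightarrow> bool" where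
  "solves_on f x J \<longleftrightarrow> (\<forall>t\<in>J. (x has_vector_derivative f (x t)) (at t within J))"

text \<open>
  Lyapunov stability together with local attractivity, for the equation x' = f x.
  Stability quantifies over solutions on arbitrary intervals [0,T), so that solutions that
  leave every neighbourhood of p in finite time are not ignored.
\<close>

definition asymptotically_stable :: "('a::real_normed_vector \<Rightarrow> 'a) \<Rightarrow> 'a \<Rightarrow> bool" where
  "asymptotically_stable f p \<longleftrightarrow>
     (\<forall>\<epsilon>>0. \<exists>d>0. \<forall>x T. T > 0 \<and> solves_on f x {0..<T} \<and> dist (x 0) p < d \<longrightarrow>
        (\<forall>t\<in>{0..<T}. dist (x t) p < \<epsilon>)) \<and>
     (\<exists>d>0. \<forall>x. solves_on f x {0..} \<and> dist (x 0) p < d \<longrightarrow> (x \<longlongrightarrow> p) at_top)"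

definition complexify :: "real^'n^'n \<Rightarrow> complex^'n^'n" where
  "complexify A = map_matrix complex_of_real A"

definition is_eigenvalue :: "'a::field^'n^'n \<Rightarrow> 'a \<Rightarrow> bool" where
  "is_eigenvalue A \<mu> \<longleftrightarrow> (\<exists>x. x \<noteq> 0 \<and> A *v x = \<mu> *s x)"

definition charpoly :: "'a::field^'n^'n \<Rightarrow> 'a poly" where
  "charpoly A = det ((\<chi> i j. (if i = j then [:0, 1:] else 0) - [:A $ i $ j:]) :: 'a poly^'n^'n)"

definition simple_eigenvalue :: "'a::field^'n^'n \<Rightarrow> 'a \<Rightarrow> bool" where
  "simple_eigenvalue A \<mu> \<longleftrightarrow> is_eigenvalue A \<mu> \<and> order \<mu> (charpoly A) = 1"

definition diagonalizable :: "'a::field^'n^'n \<Rightarrow> bool" where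
  "diagonalizable A \<longleftrightarrow>
     (\<exists>(S :: 'a^'n^'n) (D :: 'a^'n^'n). invertible S \<and> (\<forall>i j. i \<noteq> j \<longrightarrow> D $ i $ j = 0) \<and> A = S ** D ** matrix_inv S)"

definition drift_matrix :: "(real^'n \<Rightarrow> real \<Rightarrow> real^'n) \<Rightarrow> (real \<Rightarrow> real^'n) \<Rightarrow> real \<Rightarrow> real^'n^'n" where
  "drift_matrix F xstar \<alpha> = - jacobian (\<lambda>x. F x \<alpha>) (at (xstar \<alpha>))"

text \<open>
  Stationary covariance of dz = - M z dt + B dW, as the solution of the Lyapunov equation.
  The solution is unique whenever all eigenvalues of M have positive real part; otherwise
  the value may be unspecified.
\<close>

definition stationary_cov :: "real^'n^'n \<Rightarrow> real^'m^'n \<Rightarrow> real^'n^'n" where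
  "stationary_cov M B = (THE C. M ** C + C ** transpose M = B ** transpose B)"

text \<open>In the following, \<open>1 :: real^'n\<close> is the all-ones vector.\<close>

definition centering_matrix :: "real^'n^'n" where
  "centering_matrix = mat 1 - (1 / real CARD('n)) *\<^sub>R ((columnvector 1 :: real^1^'n) ** (rowvector 1 :: real^'n^1))"

definition fluctuation :: "real^'n^'n \<Rightarrow> real" where
  "fluctuation C = 1 / (real CARD('n) - 1) * trace (centering_matrix ** C)"

end

theory Submission
  imports Defs "HOL-Computational_Algebra.Fundamental_Theorem_Algebra"
begin

text \<open>
  Put \<open>s = w \<bullet> B B\<^sup>T w\<close> and \<open>R = C - s / (2 \<lambda>\<^sub>1) v v\<^sup>T\<close>. As \<open>v\<close> is a unit vector, the fluctuation of \<open>v v\<^sup>T\<close> is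
  \<open>(1 - \<rho>) / (N - 1)\<close>, so the claim is that the fluctuation of \<open>R\<close> is bounded. Pairing the Lyapunov
  equation with \<open>w\<close> on both sides gives \<open>w \<bullet> C w = s / (2 \<lambda>\<^sub>1)\<close>, hence \<open>w \<bullet> R w = 0\<close>. Therefore the
  corrected operator \<open>T X = M X + X M\<^sup>T + (w \<bullet> X w) v v\<^sup>T\<close> sends \<open>R\<close> to \<open>B B\<^sup>T - s v v\<^sup>T\<close>, which stays
  bounded. Unlike the Lyapunov operator itself, \<open>T\<close> remains injective in the limit: a matrix \<open>X\<close> in
  its kernel has \<open>X w = 0\<close> and \<open>w\<^sup>T X = 0\<close>, hence solves the homogeneous Lyapunov equation of \<open>M + v w\<^sup>T\<close>.
  The eigenvalues of the latter are \<open>\<lambda>\<^sub>1 + 1\<close> and those of \<open>M\<close> other than \<open>\<lambda>\<^sub>1\<close>, so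
  \<open>det (z - M - v w\<^sup>T)\<close> is bounded away from zero for each \<open>z\<close> in the closed left half plane, and
  the limit matrix still has its spectrum in the open right half plane. Hence \<open>T\<close> is uniformly
  bounded below near \<open>\<alpha>\<^sub>c\<close>, and \<open>R\<close> is bounded.
\<close>

section \<open>Sylvester and Lyapunov equations\<close>

text \<open>This is p(A) X, evaluated by Horner's rule; over a general field,
  \<open>mat a **\<close> serves as multiplication by the scalar a.\<close>

definition poly_act :: "'a::field^'n^'n \<Rightarrow> 'a^'n^'n \<Rightarrow> 'a poly \<Rightarrow> 'a^'n^'n" where
  "poly_act A X p = fold_coeffs (\<lambda>a Y. mat a ** X + A ** Y) p 0"

lemma mat_mult_component [simp]: "(mat a ** X) $ i $ j = a * X $ i $ j"
  for a :: "'a::semiring_1"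
  by (simp add: matrix_matrix_mult_def mat_def if_distrib[of "\<lambda>x. x * _"] cong: if_cong)

lemma matrix_mult_component: "(A ** B) $ i $ j = (\<Sum>k\<in>UNIV. A $ i $ k * B $ k $ j)"
  by (simp add: matrix_matrix_mult_def)

lemma mat_mult_commute: "A ** (mat a ** X) = mat a ** (A ** X)" for a :: "'a::comm_semiring_1"
  by (simp add: vec_eq_iff matrix_mult_component[of A] sum_distrib_left mult.left_commute)

lemma matrix_mult_zero [simp]: "A ** (0 :: 'a::semiring_1^'n^'k) = 0" "(0 :: 'a::semiring_1^'k^'m) ** B = 0"
  by (simp_all add: matrix_matrix_mult_def vec_eq_iff)

lemma matrix_add_rdistrib: "(A + B) ** C = A ** C + B ** C" for A B :: "'a::semiring_1^'k^'m"
  by (simp add: vec_eq_iff matrix_mult_component distrib_right sum.distrib)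

lemma poly_act_0 [simp]: "poly_act A X 0 = 0"
  by (simp add: poly_act_def)

lemma poly_act_pCons [simp]: "poly_act A X (pCons a p) = mat a ** X + A ** poly_act A X p"
  \<comment> \<open>When p = 0 and a = 0 the recursion of \<open>fold_coeffs\<close> does not apply,
    but both sides vanish.\<close>
  by (cases "p = 0 \<and> a = 0") (auto simp: poly_act_def)

lemma poly_act_add: "poly_act A X (p + q) = poly_act A X p + poly_act A X q"
proof (induction p q rule: poly_induct2)
  case (pCons a p b q)
  have "mat (a + b) ** X = mat a ** X + mat b ** X"
    by (simp add: vec_eq_iff distrib_right)
  then show ?case
    using pCons by (simp add: matrix_add_ldistrib)
qed simp

lemma poly_act_smult: "poly_act A X (smult c p) = mat c ** poly_act A X p"
proof (induction p)
  case (pCons a p)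
  have "mat (c * a) ** X = mat c ** (mat a ** X)"
    by (simp add: vec_eq_iff mult.assoc)
  then show ?case
    using pCons by (simp add: matrix_add_ldistrib mat_mult_commute[of A])
qed simp

lemma poly_act_linear_factor:
  "poly_act A X ([:- z, 1:] * q) = A ** poly_act A X q - mat z ** poly_act A X q"
proof -
  have "[:- z, 1:] * q = smult (- z) q + pCons 0 q"
    by simp
  moreover have "mat (- z) ** Y = - (mat z ** Y)" for Y :: "'a^'n^'n"
    by (simp add: vec_eq_iff)
  ultimately show ?thesis
    by (simp only: poly_act_add poly_act_smult) simp
qed

text \<open>Each p(A) commutes with A, so p(A) X intertwines A and B just as X does.\<close>

lemma poly_act_intertwines:
  assumes "A ** X = X ** B"
  shows "A ** poly_act A X p = poly_act A X p ** B"
proof (induction p)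
  case (pCons a p)
  have "A ** poly_act A X (pCons a p) = mat a ** (A ** X) + A ** (A ** poly_act A X p)"
    by (simp add: matrix_add_ldistrib mat_mult_commute[of A])
  also have "\<dots> = poly_act A X (pCons a p) ** B"
    unfolding pCons.IH unfolding assms by (simp add: matrix_add_rdistrib matrix_mul_assoc)
  finally show ?case .
qed simp

lemma poly_act_sum: "poly_act A X (\<Sum>i\<in>I. f i) = (\<Sum>i\<in>I. poly_act A X (f i))"
  by (induction I rule: infinite_finite_induct) (auto simp: poly_act_add)

text \<open>The matrices A^i X for i = 0, ..., d, with d the real dimension of the matrix space, are
  linearly dependent over the reals; the coefficients of a relation form p.\<close>

lemma poly_act_annihilator:
  fixes A X :: "complex^'n^'n"
  obtains p where "p \<noteq> 0" "poly_act A X p = 0"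
proof -
  define g where "g i = poly_act A X (monom 1 i)" for i
  define I where "I = {..DIM(complex^'n^'n)}"
  have act_monom: "poly_act A X (monom (of_real a) i) = a *\<^sub>R g i" for a i
  proof -
    have "monom (complex_of_real a) i = smult (complex_of_real a) (monom 1 i)"
      by (simp add: smult_monom)
    then show ?thesis
      unfolding g_def by (simp only: poly_act_smult) (simp add: vec_eq_iff scaleR_conv_of_real[where 'a = complex])
  qed
  show thesis
  proof (cases "inj_on g I")
    \<comment> \<open>Linear dependence is a property of the set of the A^i X and does not see
      repetitions, so a coincidence A^i X = A^j X is treated apart; it gives p = x^i - x^j.\<close>
    case False
    then obtain i j where ij: "i \<noteq> j" "g i = g j"
      by (auto simp: inj_on_def)
    define p where "p = monom 1 i + smult (- 1) (monom (1::complex) j)"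
    have "coeff p i = 1"
      using ij by (simp add: p_def)
    then have "p \<noteq> 0"
      by auto
    moreover have "poly_act A X p = 0"
      using ij by (simp add: p_def poly_act_add poly_act_smult g_def del: smult_minus_left)
        (simp add: vec_eq_iff)
    ultimately show thesis
      by (rule that)
  next
    case True
    have "card (g ` I) = DIM(complex^'n^'n) + 1"
      using True by (simp add: card_image I_def del: DIM_cart)
    then have "dependent (g ` I)"
      by (intro dependent_biggerset) (simp_all add: I_def del: DIM_cart)
    then obtain u k where u: "(\<Sum>Y\<in>g ` I. u Y *\<^sub>R Y) = 0" "k \<in> I" "u (g k) \<noteq> 0"
      by (subst (asm) dependent_finite) (auto simp: I_def)
    define p where "p = (\<Sum>i\<in>I. monom (complex_of_real (u (g i))) i)"
    have "coeff p k = (\<Sum>i\<in>I. if i = k then complex_of_real (u (g i)) else 0)"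
      by (simp add: p_def coeff_sum)
    also have "\<dots> = complex_of_real (u (g k))"
      using u by (simp add: I_def del: DIM_cart)
    finally have "p \<noteq> 0"
      using u by auto
    moreover have "poly_act A X p = 0"
      using u(1) by (simp add: p_def poly_act_sum act_monom sum.reindex[OF True])
    ultimately show thesis
      by (rule that)
  qed
qed

text \<open>A polynomial \<open>p\<close> of least degree with \<open>p(A) X = 0\<close> has a root \<open>\<mu>\<close>; dividing out
  the linear factor gives \<open>Y \<noteq> 0\<close> with \<open>A Y = \<mu> Y = Y B\<close>.\<close>

lemma sylvester_common_eigenvalue:
  fixes A B X :: "complex^'n^'n"
  assumes AX: "A ** X = X ** B" and "X \<noteq> 0"
  obtains \<mu> where "is_eigenvalue A \<mu>" "is_eigenvalue (transpose B) \<mu>"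
proof -
  define p where "p = arg_min degree (\<lambda>p. p \<noteq> 0 \<and> poly_act A X p = 0)"
  obtain p0 where "p0 \<noteq> 0 \<and> poly_act A X p0 = 0"
    using poly_act_annihilator by blast
  from arg_min_nat_lemma[where P = "\<lambda>p. p \<noteq> 0 \<and> poly_act A X p = 0" and m = degree, OF this]
  have p: "p \<noteq> 0" "poly_act A X p = 0"
    and min: "\<And>q. q \<noteq> 0 \<Longrightarrow> poly_act A X q = 0 \<Longrightarrow> degree p \<le> degree q"
    unfolding p_def by blast+
  have "degree p \<noteq> 0"
  proof
    assume "degree p = 0"
    then obtain c where c: "p = [:c:]"
      by (rule degree_eq_zeroE)
    with p have "mat c ** X = 0" "c \<noteq> 0"
      by auto
    then have "X = 0"
      by (simp add: vec_eq_iff)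
    with \<open>X \<noteq> 0\<close> show False ..
  qed
  then obtain \<mu> where "poly p \<mu> = 0"
    using fundamental_theorem_of_algebra[of p] constant_degree[of p] by auto
  then obtain q where q: "p = [:- \<mu>, 1:] * q"
    by (auto simp: poly_eq_0_iff_dvd elim: dvdE)
  with p have "q \<noteq> 0"
    by auto
  then have "degree p = Suc (degree q)"
    unfolding q by (subst degree_mult_eq) auto
  \<comment> \<open>The degree of q is below the minimal one, so q(A) X cannot vanish.\<close>
  then have Y0: "poly_act A X q \<noteq> 0"
    using min[OF \<open>q \<noteq> 0\<close>] by auto
  define Y where "Y = poly_act A X q"
  have AY: "A ** Y = mat \<mu> ** Y"
    using p(2) unfolding q poly_act_linear_factor Y_def by simp
  then have YB: "Y ** B = mat \<mu> ** Y"
    using poly_act_intertwines[OF AX, of q] by (simp add: Y_def)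
  obtain i j where ij: "Y $ i $ j \<noteq> 0"
    using Y0 by (auto simp: Y_def vec_eq_iff)
  \<comment> \<open>Since A Y = \<mu> Y, a column of Y through a nonzero entry is an eigenvector of
    A. Since Y B = \<mu> Y, the rows serve \<open>transpose B\<close> in the same way.\<close>
  have "A *v column j Y = \<mu> *s column j Y"
    unfolding vec_eq_iff
  proof
    fix k
    have "(A *v column j Y) $ k = (A ** Y) $ k $ j"
      by (simp add: matrix_vector_mult_def matrix_mult_component column_def)
    then show "(A *v column j Y) $ k = (\<mu> *s column j Y) $ k"
      by (simp add: AY column_def)
  qed
  moreover have "column j Y \<noteq> 0"
    using ij by (auto simp: column_def vec_eq_iff)
  ultimately have "is_eigenvalue A \<mu>"
    unfolding is_eigenvalue_def by blast
  moreover have "transpose B *v row i Y = \<mu> *s row i Y"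
    unfolding vec_eq_iff
  proof
    fix k
    have "(transpose B *v row i Y) $ k = (Y ** B) $ i $ k"
      by (simp add: matrix_vector_mult_def matrix_mult_component row_def transpose_def mult.commute)
    then show "(transpose B *v row i Y) $ k = (\<mu> *s row i Y) $ k"
      by (simp add: YB row_def)
  qed
  moreover have "row i Y \<noteq> 0"
    using ij by (auto simp: row_def vec_eq_iff)
  ultimately show thesis
    using that unfolding is_eigenvalue_def by blast
qed

lemma complexify_mult: "complexify (A ** B) = complexify A ** complexify B"
  by (simp add: complexify_def map_matrix_def matrix_matrix_mult_def vec_eq_iff)

lemma complexify_transpose: "complexify (transpose A) = transpose (complexify A)"
  by (simp add: complexify_def map_matrix_def transpose_def vec_eq_iff)

lemma complexify_component [simp]: "complexify A $ i $ j = of_real (A $ i $ j)"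
  by (simp add: complexify_def map_matrix_def)

text \<open>The equation reads A X = X (-A)^T, so a nonzero X would give A and -A a common
  eigenvalue \<mu>. Then \<mu> and -\<mu> would both be eigenvalues of A with positive real
  part.\<close>

lemma lyapunov_injective:
  fixes A X :: "real^'n^'n"
  assumes spec: "\<And>\<mu>. is_eigenvalue (complexify A) \<mu> \<Longrightarrow> Re \<mu> > 0"
    and eq: "A ** X + X ** transpose A = 0"
  shows "X = 0"
proof (rule ccontr)
  assume "X \<noteq> 0"
  then have "complexify X \<noteq> 0"
    by (auto simp: vec_eq_iff)
  have "complexify A ** complexify X = complexify (A ** X)"
    by (simp add: complexify_mult)
  also have "A ** X = X ** transpose (- A)"
    using eq by (simp add: vec_eq_iff matrix_matrix_mult_def transpose_def sum_negf eq_neg_iff_add_eq_0)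
  finally have "complexify A ** complexify X = complexify X ** complexify (transpose (- A))"
    by (simp add: complexify_mult)
  from sylvester_common_eigenvalue[OF this \<open>complexify X \<noteq> 0\<close>]
  obtain \<mu> where \<mu>: "is_eigenvalue (complexify A) \<mu>" "is_eigenvalue (complexify (- A)) \<mu>"
    by (auto simp: complexify_transpose)
  have "complexify (- A) *v x = - (complexify A *v x)" for x
    by (simp add: vec_eq_iff matrix_vector_mult_def sum_negf)
  then have "is_eigenvalue (complexify A) (- \<mu>)"
    using \<mu>(2) by (auto simp: is_eigenvalue_def vec_eq_iff minus_equation_iff)
  then show False
    using spec[OF \<mu>(1)] spec[of "- \<mu>"] by simp
qed

section \<open>Moving the critical eigenvalue by a rank one matrix\<close>

definition outer_prod :: "'a::times^'m \<Rightarrow> 'a^'n \<Rightarrow> 'a^'n^'m" where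
  "outer_prod x y = (\<chi> i j. x $ i * y $ j)"

lemma outer_prod_component [simp]: "outer_prod x y $ i $ j = x $ i * y $ j"
  by (simp add: outer_prod_def)

lemma mult_outer_prod: "A ** outer_prod x y = outer_prod (A *v x) y" for A :: "'a::comm_semiring_1^'n^'m"
  by (simp add: vec_eq_iff matrix_mult_component matrix_vector_mult_def sum_distrib_right mult.assoc)

lemma outer_prod_mult: "outer_prod x y ** A = outer_prod x (y v* A)" for A :: "'a::comm_semiring_1^'n^'m"
  by (simp add: vec_eq_iff matrix_mult_component vector_matrix_mult_def sum_distrib_left mult_ac)

section \<open>Characteristic polynomials and diagonal conjugates\<close>

lemma poly_det: "poly (det P) z = det (\<chi> i j. poly (P $ i $ j) z)" for P :: "'a::comm_ring_1 poly^'n^'n"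
  by (simp add: det_def poly_sum poly_prod)

lemma poly_charpoly: "poly (charpoly A) z = det (mat z - A)"
proof -
  have "(\<chi> i j. poly (((\<chi> i j. (if i = j then [:0, 1:] else 0) - [:A $ i $ j:]) :: 'a poly^'b^'b) $ i $ j) z)
    = mat z - A"
    by (simp add: vec_eq_iff mat_def)
  then show ?thesis
    by (simp add: charpoly_def poly_det)
qed

lemma matrix_inv_invertible:
  fixes A :: "'a::semiring_1^'n^'n"
  assumes "invertible A"
  shows matrix_inv_right: "A ** matrix_inv A = mat 1" and matrix_inv_left: "matrix_inv A ** A = mat 1"
  using someI_ex[OF assms[unfolded invertible_def]] unfolding matrix_inv_def by blast+

lemma det_conjugate:
  fixes S D :: "'a::field^'n^'n"
  assumes "invertible S"
  shows "det (S ** D ** matrix_inv S) = det D"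
proof -
  have "det S * det (matrix_inv S) = 1"
    using assms by (metis det_mul det_I matrix_inv_right)
  then show ?thesis
    by (simp add: det_mul)
qed

lemma mat_conjugate:
  fixes S :: "'a::field^'n^'n"
  assumes "invertible S"
  shows "mat z - S ** D ** matrix_inv S = S ** (mat z - D) ** matrix_inv S"
proof -
  have "S ** mat z = mat z ** S"
    using mat_mult_commute[of S z "mat 1"] by simp
  then have "S ** mat z ** matrix_inv S = mat z"
    using assms by (simp add: matrix_mul_assoc [symmetric] matrix_inv_right)
  moreover have "S ** (mat z - D) ** matrix_inv S = S ** mat z ** matrix_inv S - S ** D ** matrix_inv S"
    by (simp add: vec_eq_iff matrix_mult_component left_diff_distrib right_diff_distrib sum_subtractf)
  ultimately show ?thesis
    by simp
qed

text \<open>Evaluation at z gives det (z - D), a product over the diagonal. Polynomials that agree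
  as functions are equal because characteristic 0 makes the field infinite.\<close>

lemma charpoly_diagonal_conjugate:
  fixes S D :: "'a::field_char_0^'n^'n"
  assumes "invertible S" and D: "\<And>i j. i \<noteq> j \<Longrightarrow> D $ i $ j = 0"
  shows "charpoly (S ** D ** matrix_inv S) = (\<Prod>i\<in>UNIV. [:- (D $ i $ i), 1:])"
proof -
  have "det (mat z - D) = (\<Prod>i\<in>UNIV. z - D $ i $ i)" for z
    by (subst det_diagonal) (simp_all add: D mat_def)
  then have "poly (charpoly (S ** D ** matrix_inv S)) = poly (\<Prod>i\<in>UNIV. [:- (D $ i $ i), 1:])"
    using assms(1) by (simp add: fun_eq_iff poly_charpoly mat_conjugate det_conjugate poly_prod)
  then show ?thesis
    by (simp add: poly_eq_poly_eq_iff)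
qed

text \<open>A second diagonal entry \<mu> would make the square of x - \<mu> divide the
  characteristic polynomial, against order 1.\<close>

lemma simple_eigenvalue_diagonal_unique:
  fixes S D :: "'a::field_char_0^'n^'n"
  assumes "invertible S" and D: "\<And>i j. i \<noteq> j \<Longrightarrow> D $ i $ j = 0"
    and simple: "simple_eigenvalue (S ** D ** matrix_inv S) \<mu>"
    and ij: "D $ i $ i = \<mu>" "D $ j $ j = \<mu>"
  shows "i = j"
proof (rule ccontr)
  assume "i \<noteq> j"
  let ?p = "\<lambda>k. [:- (D $ k $ k), 1:]"
  have "(\<Prod>k\<in>UNIV. ?p k) = ?p i * (?p j * (\<Prod>k\<in>UNIV - {i} - {j}. ?p k))"
    using \<open>i \<noteq> j\<close> by (subst prod.remove[of _ i], simp, simp, subst prod.remove[of _ j]) auto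
  then have "[:- \<mu>, 1:] ^ 2 dvd charpoly (S ** D ** matrix_inv S)"
    using ij assms(1) D by (simp add: charpoly_diagonal_conjugate power2_eq_square mult.assoc[symmetric]
        del: mult_pCons_left mult_pCons_right)
  moreover have "charpoly (S ** D ** matrix_inv S) \<noteq> 0"
    using assms(1) D by (simp add: charpoly_diagonal_conjugate)
  ultimately show False
    using simple unfolding order_divides simple_eigenvalue_def by auto
qed

lemma is_eigenvalue_diagonal_conjugate:
  fixes S D :: "'a::field^'n^'n"
  assumes "invertible S" and D: "\<And>i j. i \<noteq> j \<Longrightarrow> D $ i $ j = 0"
  shows "is_eigenvalue (S ** D ** matrix_inv S) (D $ i $ i)"
proof -
  \<comment> \<open>The eigenvector is the i-th column of S.\<close>
  define x where "x = S *v axis i 1"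
  have x: "matrix_inv S *v x = axis i 1"
    using assms(1) by (simp add: x_def matrix_vector_mul_assoc matrix_inv_left)
  have "(D *v axis i 1) $ j = (D $ i $ i *s axis i 1) $ j" for j
    using D[of j i]
    by (simp add: matrix_vector_mult_def axis_def if_distrib[of "\<lambda>x. _ * x"] cong: if_cong)
  then have "D *v axis i 1 = D $ i $ i *s axis i 1"
    by (simp add: vec_eq_iff)
  then have "(S ** D ** matrix_inv S) *v x = D $ i $ i *s x"
    by (simp add: matrix_vector_mul_assoc [symmetric] x) (simp add: x_def vector_scalar_commute)
  moreover have "x \<noteq> 0"
    using x by (auto simp: axis_eq_0_iff)
  ultimately show ?thesis
    unfolding is_eigenvalue_def by blast
qed

text \<open>In coordinates that diagonalize A, simplicity of l confines v and w to one coordinate k,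
  and the pairing 1 turns v w^T into the diagonal matrix unit at k. So the shift moves l to l + 1
  and keeps the other eigenvalues. The bound does not involve the diagonalizing matrix S, whose
  conditioning near the limit is not controlled.\<close>

lemma det_rank_one_shift_lower_bound:
  fixes A :: "complex^'n^'n" and v w :: "complex^'n"
  assumes diag: "diagonalizable A" and simple: "simple_eigenvalue A (of_real l)" and "l > 0"
    and v: "A *v v = of_real l *s v" and w: "w v* A = of_real l *s w"
    and wv: "(\<Sum>i\<in>UNIV. w $ i * v $ i) = 1"
    and gap: "\<And>\<mu>. is_eigenvalue A \<mu> \<Longrightarrow> \<mu> \<noteq> of_real l \<Longrightarrow> Re \<mu> \<ge> \<delta>"
    and "\<delta> > 0" "Re z \<le> 0"
  shows "norm (det (mat z - (A + outer_prod v w))) \<ge> min 1 \<delta> ^ CARD('n)"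
proof -
  obtain S D :: "complex^'n^'n" where S: "invertible S" and D: "\<And>i j. i \<noteq> j \<Longrightarrow> D $ i $ j = 0"
    and A: "A = S ** D ** matrix_inv S"
    using diag unfolding diagonalizable_def by metis
  have SS: "matrix_inv S ** S = mat 1" "S ** matrix_inv S = mat 1"
    using S by (simp_all add: matrix_inv_left matrix_inv_right)
  define x where "x = matrix_inv S *v v"
  define y where "y = w v* S"
  have Dx: "(D *v u) $ i = D $ i $ i * u $ i" for u i
    unfolding matrix_vector_mult_def using D by (simp add: sum.remove[of _ i])
  have Dy: "(u v* D) $ i = u $ i * D $ i $ i" for u i
    unfolding vector_matrix_mult_def using D by (simp add: sum.remove[of _ i])
  have "matrix_inv S *v (A *v v) = (matrix_inv S ** S) *v (D *v x)"
    by (simp only: A x_def matrix_vector_mul_assoc matrix_mul_assoc)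
  then have "D *v x = of_real l *s x"
    by (simp add: SS v x_def vector_scalar_commute)
  then have x0: "x $ i = 0" if "D $ i $ i \<noteq> of_real l" for i
    using that Dx[of x i] by simp
  have "(w v* A) v* S = (y v* D) v* (matrix_inv S ** S)"
    by (simp only: A y_def vector_matrix_mul_assoc matrix_mul_assoc)
  then have "y v* D = of_real l *s y"
    by (simp add: SS w y_def scalar_vector_matrix_assoc)
  then have y0: "y $ i = 0" if "D $ i $ i \<noteq> of_real l" for i
    using that Dy[of y i] by (simp add: mult.commute)
  \<comment> \<open>The pairing of w and v does not depend on the coordinates.\<close>
  have "(\<Sum>i\<in>UNIV. y $ i * x $ i) = (\<Sum>i\<in>UNIV. w $ i * (S *v x) $ i)"
    unfolding y_def vector_matrix_mult_def matrix_vector_mult_def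
    by (simp add: sum_distrib_left sum_distrib_right mult_ac) (subst sum.swap, simp add: mult_ac)
  also have "S *v x = v"
    by (simp add: x_def matrix_vector_mul_assoc SS)
  finally have yx: "(\<Sum>i\<in>UNIV. y $ i * x $ i) = 1"
    using wv by simp
  \<comment> \<open>A sum equal to 1 has a nonzero term; its index k carries the eigenvalue l, and
    simplicity makes it the only such index.\<close>
  then obtain k where k: "y $ k * x $ k \<noteq> 0"
    by (metis (mono_tags, lifting) sum.neutral zero_neq_one)
  then have Dk: "D $ k $ k = of_real l"
    using x0 by force
  have unique: "i = k" if "D $ i $ i = of_real l" for i
    using simple_eigenvalue_diagonal_unique[OF S D, of "of_real l" i k] simple Dk that A by simp
  have x_off: "x $ i = 0" and y_off: "y $ i = 0" if "i \<noteq> k" for i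
    using x0 y0 unique that by blast+
  then have "(\<Sum>i\<in>UNIV - {k}. y $ i * x $ i) = 0"
    by (intro sum.neutral) auto
  then have yxk: "y $ k * x $ k = 1"
    using yx by (simp add: sum.remove[of _ k])
  define E where "E = outer_prod x y"
  have E0: "E $ i $ j = 0" if "i \<noteq> j" for i j
    using that x_off[of i] y_off[of j] by (cases "i = k") (simp_all add: E_def)
  have Ei: "E $ i $ i = (if i = k then 1 else 0)" for i
    using x_off[of i] yxk by (simp add: E_def mult.commute)
  have "outer_prod v w = outer_prod ((S ** matrix_inv S) *v v) (w v* (S ** matrix_inv S))"
    by (simp add: SS)
  also have "\<dots> = S ** E ** matrix_inv S"
    by (simp only: E_def x_def y_def mult_outer_prod outer_prod_mult matrix_vector_mul_assoc vector_matrix_mul_assoc)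
  finally have "A + outer_prod v w = S ** (D + E) ** matrix_inv S"
    by (simp add: A matrix_add_ldistrib matrix_add_rdistrib)
  then have "det (mat z - (A + outer_prod v w)) = det (mat z - (D + E))"
    using S by (simp add: mat_conjugate det_conjugate)
  also have "\<dots> = (\<Prod>i\<in>UNIV. z - (D $ i $ i + E $ i $ i))"
    by (subst det_diagonal) (simp_all add: D E0 mat_def)
  finally have "norm (det (mat z - (A + outer_prod v w))) = (\<Prod>i\<in>UNIV. norm (z - (D $ i $ i + E $ i $ i)))"
    by (simp add: prod_norm)
  also have "\<dots> \<ge> (\<Prod>i\<in>(UNIV :: 'n set). min 1 \<delta>)"
  proof (rule prod_mono, intro conjI)
    fix i :: 'n
    show "0 \<le> min 1 \<delta>"
      using \<open>\<delta> > 0\<close> by simp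
    have "min 1 \<delta> \<le> Re (D $ i $ i + E $ i $ i)"
    proof (cases "i = k")
      case True
      then show ?thesis
        using Dk Ei \<open>l > 0\<close> by simp
    next
      case False
      then have "D $ i $ i \<noteq> of_real l"
        using unique by blast
      then have "Re (D $ i $ i) \<ge> \<delta>"
        using gap[of "D $ i $ i"] is_eigenvalue_diagonal_conjugate[OF S D, of i] by (simp add: A)
      then show ?thesis
        using False Ei by simp
    qed
    \<comment> \<open>As Re z \<le> 0, the distance from z to a point is at least the real part of
      that point.\<close>
    also have "\<dots> \<le> norm (z - (D $ i $ i + E $ i $ i))"
      using \<open>Re z \<le> 0\<close> abs_Re_le_cmod[of "z - (D $ i $ i + E $ i $ i)"] by simp
    finally show "min 1 \<delta> \<le> norm (z - (D $ i $ i + E $ i $ i))" .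
  qed
  finally show ?thesis
    by simp
qed

lemma is_eigenvalue_det: "is_eigenvalue A \<mu> \<Longrightarrow> det (mat \<mu> - A) = 0"
proof -
  assume "is_eigenvalue A \<mu>"
  then obtain x where x: "x \<noteq> 0" "A *v x = \<mu> *s x"
    unfolding is_eigenvalue_def by blast
  have "mat \<mu> *v x = \<mu> *s x"
    by (simp add: vec_eq_iff matrix_vector_mult_def mat_def if_distrib[of "\<lambda>x. x * _"] cong: if_cong)
  then have "(mat \<mu> - A) *v x = 0"
    using x by (simp add: matrix_vector_mult_diff_rdistrib)
  then have "\<not> invertible (mat \<mu> - A)"
    using x(1) by (metis invertible_def matrix_left_invertible_ker)
  then show ?thesis
    by (simp add: invertible_det_nz)
qed

text \<open>If v is an eigenvector of A and w . v = 1, the last term adds 1 to the eigenvalue of the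
  Lyapunov operator at v v^T, which lifts a vanishing eigenvalue there. With v = w = 0 the plain
  Lyapunov operator remains.\<close>

definition shifted_lyapunov :: "real^'n^'n \<Rightarrow> real^'n \<Rightarrow> real^'n \<Rightarrow> real^'n^'n \<Rightarrow> real^'n^'n" where
  "shifted_lyapunov A v w X = A ** X + X ** transpose A + (w \<bullet> (X *v w)) *\<^sub>R outer_prod v v"

lemma scaleR_matrix_mult: "(c *\<^sub>R A) ** B = c *\<^sub>R (A ** B)" "A ** (c *\<^sub>R B) = c *\<^sub>R (A ** B)"
  for A :: "real^'n^'m"
  by (simp_all add: vec_eq_iff matrix_mult_component sum_distrib_left mult_ac)

lemma linear_shifted_lyapunov: "linear (shifted_lyapunov A v w)"
proof (rule linearI)
  show "shifted_lyapunov A v w (X + Y) = shifted_lyapunov A v w X + shifted_lyapunov A v w Y" for X Y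
    unfolding shifted_lyapunov_def
    by (simp add: matrix_add_ldistrib matrix_add_rdistrib matrix_vector_mult_add_rdistrib inner_add_right
        scaleR_add_left)
  show "shifted_lyapunov A v w (c *\<^sub>R X) = c *\<^sub>R shifted_lyapunov A v w X" for c X
    unfolding shifted_lyapunov_def
    by (simp add: scaleR_matrix_mult scaleR_matrix_vector_assoc[symmetric] scaleR_add_right)
qed

text \<open>This is the limiting case of critical eigenvalue 0. Pairing the equation with w on both
  sides isolates w . X w; multiplication by w on one side at a time then gives X w = 0 and w^T X =
  0.\<close>

lemma shifted_lyapunov_injective:
  fixes A X :: "real^'n^'n"
  assumes v: "A *v v = 0" and w: "w v* A = 0" and wv: "w \<bullet> v = 1"
    and spec: "\<And>\<mu>. is_eigenvalue (complexify (A + outer_prod v w)) \<mu> \<Longrightarrow> Re \<mu> > 0"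
    and eq: "shifted_lyapunov A v w X = 0"
  shows "X = 0"
proof -
  let ?H = "A + outer_prod v w"
  have outer: "outer_prod p q *v u = (q \<bullet> u) *\<^sub>R p" for p q u :: "real^'n"
    by (simp add: vec_eq_iff matrix_vector_mult_def inner_vec_def sum_distrib_left mult_ac)
  have Aw: "transpose A *v w = 0"
    using w by simp
  have wA: "w \<bullet> (A *v u) = 0" for u
    by (simp add: w dot_lmul_matrix[symmetric])
  \<comment> \<open>On the hyperplane w . u = 0 the matrices A and A + v w^T agree, so a nonzero u
    there with A u = 0 would give the latter the eigenvalue 0.\<close>
  have ker: "u = 0" if "A *v u = 0" "w \<bullet> u = 0" for u
  proof (rule ccontr)
    assume "u \<noteq> 0"
    define cu :: "complex^'n" where "cu = (\<chi> i. of_real (u $ i))"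
    have "?H *v u = 0"
      using that by (simp add: matrix_vector_mult_add_rdistrib outer)
    moreover have "(complexify ?H *v cu) $ i = of_real ((?H *v u) $ i)" for i
      by (simp add: matrix_vector_mult_def cu_def)
    ultimately have "complexify ?H *v cu = 0 *s cu"
      by (simp add: vec_eq_iff)
    moreover have "cu \<noteq> 0"
      using \<open>u \<noteq> 0\<close> by (auto simp: cu_def vec_eq_iff)
    ultimately have "is_eigenvalue (complexify ?H) 0"
      unfolding is_eigenvalue_def by blast
    from spec[OF this] show False
      by simp
  qed
  have "w \<bullet> (shifted_lyapunov A v w X *v w) = w \<bullet> (X *v w)"
    using wv by (simp add: shifted_lyapunov_def matrix_vector_mult_add_rdistrib inner_add_right
        matrix_vector_mul_assoc[symmetric] Aw wA scaleR_matrix_vector_assoc[symmetric] outer inner_commute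
        del: transpose_matrix_vector)
  then have wXw: "w \<bullet> (X *v w) = 0"
    by (simp add: eq)
  with eq have lyap: "A ** X + X ** transpose A = 0"
    by (simp add: shifted_lyapunov_def)
  have "(A ** X + X ** transpose A) *v w = A *v (X *v w)"
    by (simp add: matrix_vector_mult_add_rdistrib matrix_vector_mul_assoc[symmetric] Aw
        del: transpose_matrix_vector)
  then have "A *v (X *v w) = 0"
    by (simp add: lyap)
  from ker[OF this wXw] have Xw: "X *v w = 0" .
  \<comment> \<open>Here w^T A X vanishes, and w^T X A^T is A applied to w^T X read as a vector, so
    \<open>ker\<close> applies again.\<close>
  have "w v* (A ** X + X ** transpose A) = A *v (w v* X)"
    by (simp add: vector_matrix_mult_add_rdistrib vector_matrix_mul_assoc[symmetric] w)
  then have "A *v (w v* X) = 0"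
    by (simp add: lyap)
  moreover have "w \<bullet> (w v* X) = 0"
    using wXw by (subst inner_commute) (simp add: dot_lmul_matrix)
  ultimately have wX: "w v* X = 0"
    by (rule ker)
  have tr: "transpose ?H = transpose A + outer_prod w v"
    by (simp add: vec_eq_iff transpose_def mult.commute)
  \<comment> \<open>The additional terms v (w^T X) and (X w) v^T are both zero.\<close>
  have "?H ** X + X ** transpose ?H = 0"
    unfolding tr using lyap
    by (simp add: matrix_add_rdistrib matrix_add_ldistrib outer_prod_mult mult_outer_prod Xw wX)
      (simp add: vec_eq_iff)
  then show "X = 0"
    using lyapunov_injective[OF spec] by blast
qed

section \<open>Passage to the limit\<close>

lemma tendsto_matrix_mult [tendsto_intros]:
  fixes A :: "'x \<Rightarrow> 'a::real_normed_algebra_1^'k^'m"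
  assumes "(A \<longlongrightarrow> A0) F" "(B \<longlongrightarrow> B0) F"
  shows "((\<lambda>x. A x ** B x) \<longlongrightarrow> A0 ** B0) F"
  unfolding matrix_matrix_mult_def by (intro tendsto_intros assms)

lemma tendsto_matrix_vector_mult [tendsto_intros]:
  fixes A :: "'x \<Rightarrow> 'a::real_normed_algebra_1^'k^'m"
  assumes "(A \<longlongrightarrow> A0) F" "(u \<longlongrightarrow> u0) F"
  shows "((\<lambda>x. A x *v u x) \<longlongrightarrow> A0 *v u0) F"
  unfolding matrix_vector_mult_def by (intro tendsto_intros assms)

lemma tendsto_transpose [tendsto_intros]:
  assumes "(A \<longlongrightarrow> A0) F"
  shows "((\<lambda>x. transpose (A x)) \<longlongrightarrow> transpose A0) F"
  unfolding transpose_def by (intro tendsto_intros assms)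

lemma tendsto_outer_prod [tendsto_intros]:
  fixes u :: "'x \<Rightarrow> 'a::real_normed_algebra^'m"
  assumes "(u \<longlongrightarrow> u0) F" "(v \<longlongrightarrow> v0) F"
  shows "((\<lambda>x. outer_prod (u x) (v x)) \<longlongrightarrow> outer_prod u0 v0) F"
  unfolding outer_prod_def by (intro tendsto_intros assms)

lemma tendsto_det [tendsto_intros]:
  fixes A :: "'x \<Rightarrow> 'a::real_normed_field^'m^'m"
  assumes "(A \<longlongrightarrow> A0) F"
  shows "((\<lambda>x. det (A x)) \<longlongrightarrow> det A0) F"
  unfolding det_def by (intro tendsto_intros assms)

lemma tendsto_complexify [tendsto_intros]:
  assumes "(A \<longlongrightarrow> A0) F"
  shows "((\<lambda>x. complexify (A x)) \<longlongrightarrow> complexify A0) F"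
  unfolding complexify_def map_matrix_def by (intro tendsto_intros assms)

text \<open>In finite dimension an injective linear map is bounded below, and pointwise convergence
  of linear maps is convergence in operator norm. Hence half of the lower bound of \<open>T0\<close>
  survives near the limit.\<close>

lemma tendsto_linear_bounded_below:
  fixes T :: "'x \<Rightarrow> 'a::euclidean_space \<Rightarrow> 'b::euclidean_space"
  assumes lin: "\<And>\<alpha>. linear (T \<alpha>)" "linear T0" and "inj T0"
    and lim: "\<And>x. ((\<lambda>\<alpha>. T \<alpha> x) \<longlongrightarrow> T0 x) F"
  obtains m where "m > 0" "\<forall>\<^sub>F \<alpha> in F. \<forall>x. m * norm x \<le> norm (T \<alpha> x)"
proof -
  obtain m where m: "m > 0" "\<And>x. m * norm x \<le> norm (T0 x)"
    using linear_inj_bounded_below_pos[OF lin(2) \<open>inj T0\<close>] by metis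
  \<comment> \<open>This sum over the finite basis dominates the operator norm of
    \<open>T \<alpha> - T0\<close>.\<close>
  define e where "e \<alpha> = (\<Sum>b\<in>Basis. norm (T \<alpha> b - T0 b))" for \<alpha>
  have diff: "norm (T \<alpha> x - T0 x) \<le> e \<alpha> * norm x" for \<alpha> x
  proof -
    have "T \<alpha> x - T0 x = (\<Sum>b\<in>Basis. (x \<bullet> b) *\<^sub>R (T \<alpha> b - T0 b))"
      using linear_sum[OF linear_compose_sub[OF lin(1)[of \<alpha>] lin(2)], of "\<lambda>b. (x \<bullet> b) *\<^sub>R b" Basis]
      by (simp add: euclidean_representation linear_cmul[OF lin(1)] linear_cmul[OF lin(2)]
          scaleR_diff_right)
    also have "norm \<dots> \<le> (\<Sum>b\<in>Basis. norm (T \<alpha> b - T0 b) * norm x)"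
    proof (rule sum_norm_le)
      fix b :: 'a assume "b \<in> Basis"
      then show "norm ((x \<bullet> b) *\<^sub>R (T \<alpha> b - T0 b)) \<le> norm (T \<alpha> b - T0 b) * norm x"
        using mult_right_mono[OF Basis_le_norm[of b x] norm_ge_zero[of "T \<alpha> b - T0 b"]]
        by (simp add: mult.commute)
    qed
    finally show ?thesis
      by (simp add: e_def sum_distrib_right)
  qed
  have "(e \<longlongrightarrow> (\<Sum>b\<in>Basis. norm (T0 b - T0 b))) F"
    unfolding e_def by (intro tendsto_intros lim)
  then have "(e \<longlongrightarrow> 0) F"
    by simp
  then have "\<forall>\<^sub>F \<alpha> in F. e \<alpha> < m / 2"
    using m(1) by (intro order_tendstoD) auto
  then have "\<forall>\<^sub>F \<alpha> in F. \<forall>x. m / 2 * norm x \<le> norm (T \<alpha> x)"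
  proof eventually_elim
    case (elim \<alpha>)
    show ?case
    proof
      fix x :: 'a
      have "e \<alpha> * norm x \<le> m / 2 * norm x"
        using elim by (intro mult_right_mono) auto
      moreover have "norm (T0 x) \<le> norm (T \<alpha> x) + norm (T \<alpha> x - T0 x)"
        by (metis add.commute norm_minus_commute norm_triangle_sub)
      ultimately show "m / 2 * norm x \<le> norm (T \<alpha> x)"
        using diff[of \<alpha> x] m(2)[of x] by linarith
    qed
  qed
  then show thesis
    using m(1) that[of "m / 2"] by simp
qed

text \<open>Up to sign, \<open>drift_matrix\<close> is the x-part of the full derivative, which is
  differentiable and hence continuous at the endpoint of the branch.\<close>

lemma tendsto_drift_matrix:
  fixes F :: "real^'n \<Rightarrow> real \<Rightarrow> real^'n"
  assumes smooth: "C2_on (\<lambda>(x, \<alpha>). F x \<alpha>) U"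
    and U: "\<forall>\<^sub>F \<alpha> in at_left \<alpha>c. (xstar \<alpha>, \<alpha>) \<in> U" "(xc, \<alpha>c) \<in> U"
    and lim: "(xstar \<longlongrightarrow> xc) (at_left \<alpha>c)"
  obtains Mc where "(drift_matrix F xstar \<longlongrightarrow> Mc) (at_left \<alpha>c)"
proof -
  obtain f' f'' where
    f': "\<And>p. p \<in> U \<Longrightarrow> ((\<lambda>(x, \<alpha>). F x \<alpha>) has_derivative blinfun_apply (f' p)) (at p)" and
    f'': "\<And>p. p \<in> U \<Longrightarrow> (f' has_derivative blinfun_apply (f'' p)) (at p)"
    using smooth unfolding C2_on_def by blast
  \<comment> \<open>Column j is the derivative in the direction (e_j, 0), so J is the Jacobian in x
    alone.\<close>
  define J where "J p = (\<chi> i j. blinfun_apply (f' p) (axis j 1, 0) $ i)" for p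
  have jac: "jacobian (\<lambda>x. F x \<alpha>) (at x) = J (x, \<alpha>)" if "(x, \<alpha>) \<in> U" for x \<alpha>
  proof -
    have "((\<lambda>x. (x, \<alpha>)) has_derivative (\<lambda>h. (h, 0))) (at x)"
      by (auto intro!: derivative_eq_intros)
    then have "((\<lambda>x. F x \<alpha>) has_derivative (\<lambda>h. blinfun_apply (f' (x, \<alpha>)) (h, 0))) (at x)"
      using has_derivative_compose[of "\<lambda>x. (x, \<alpha>)" "\<lambda>h. (h, 0)" x UNIV "\<lambda>(x, \<alpha>). F x \<alpha>"
          "blinfun_apply (f' (x, \<alpha>))", OF _ f'[OF that]]
      by (simp only: prod.case)
    then have "frechet_derivative (\<lambda>x. F x \<alpha>) (at x) = (\<lambda>h. blinfun_apply (f' (x, \<alpha>)) (h, 0))"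
      by (rule frechet_derivative_at[symmetric])
    then show ?thesis
      by (simp add: jacobian_def matrix_def J_def)
  qed
  have "isCont f' (xc, \<alpha>c)"
    using f''[OF U(2)] has_derivative_continuous by blast
  moreover have "((\<lambda>\<alpha>. (xstar \<alpha>, \<alpha>)) \<longlongrightarrow> (xc, \<alpha>c)) (at_left \<alpha>c)"
    by (intro tendsto_intros lim)
  ultimately have "((\<lambda>\<alpha>. f' (xstar \<alpha>, \<alpha>)) \<longlongrightarrow> f' (xc, \<alpha>c)) (at_left \<alpha>c)"
    by (rule isCont_tendsto_compose)
  then have "((\<lambda>\<alpha>. - J (xstar \<alpha>, \<alpha>)) \<longlongrightarrow> - J (xc, \<alpha>c)) (at_left \<alpha>c)"
    unfolding J_def by (intro tendsto_intros)
  moreover have "\<forall>\<^sub>F \<alpha> in at_left \<alpha>c. - J (xstar \<alpha>, \<alpha>) = drift_matrix F xstar \<alpha>"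
    using U(1) by eventually_elim (simp add: drift_matrix_def jac)
  ultimately have "(drift_matrix F xstar \<longlongrightarrow> - J (xc, \<alpha>c)) (at_left \<alpha>c)"
    by (rule Lim_transform_eventually)
  then show thesis
    by (rule that)
qed

text \<open>The definition uses \<open>THE\<close>, so existence and uniqueness are both due. The
  spectral hypothesis makes the Lyapunov operator injective, hence surjective on the finite
  dimensional space of matrices.\<close>

lemma stationary_cov_lyapunov:
  fixes A :: "real^'n^'n" and B :: "real^'m^'n"
  assumes spec: "\<And>\<mu>. is_eigenvalue (complexify A) \<mu> \<Longrightarrow> Re \<mu> > 0"
  shows "A ** stationary_cov A B + stationary_cov A B ** transpose A = B ** transpose B"
proof -
  define L where "L X = A ** X + X ** transpose A" for X
  have lin: "linear L"
    using linear_shifted_lyapunov[of A 0 0] by (simp add: shifted_lyapunov_def[abs_def] L_def[abs_def])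
  have inj: "inj L"
    unfolding linear_injective_0[OF lin] L_def
    by (intro allI impI, rule lyapunov_injective[of A, OF spec]) assumption+
  obtain C where C: "L C = B ** transpose B"
    using linear_injective_imp_surjective[OF lin inj] by (metis surjD)
  have "L (THE C. L C = B ** transpose B) = B ** transpose B"
    using C by (rule theI) (rule injD[OF inj], simp add: C)
  then show ?thesis
    by (simp only: L_def stationary_cov_def)
qed

section \<open>The fluctuation as a linear functional\<close>

lemma linear_fluctuation: "linear (fluctuation :: real^'n^'n \<Rightarrow> real)"
proof (rule linearI)
  show "fluctuation (X + Y) = fluctuation X + fluctuation Y" for X Y :: "real^'n^'n"
    by (simp add: fluctuation_def matrix_add_ldistrib trace_def sum.distrib distrib_left)
  show "fluctuation (c *\<^sub>R X) = c *\<^sub>R fluctuation X" for c and X :: "real^'n^'n"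
    by (simp add: fluctuation_def scaleR_matrix_mult trace_def sum_distrib_left mult_ac)
qed

lemma trace_outer_prod: "trace (outer_prod x y) = x \<bullet> y" for x y :: "real^'n"
  by (simp add: trace_def inner_vec_def)

text \<open>With P the centering matrix, Tr (P v v^T) = v . P v. For a unit vector v the numerator
  is 1 - \<rho>.\<close>

lemma fluctuation_outer_prod:
  fixes v :: "real^'n"
  shows "fluctuation (outer_prod v v) = (v \<bullet> v - (1 \<bullet> v)\<^sup>2 / real CARD('n)) / (real CARD('n) - 1)"
proof -
  have "(columnvector x :: real^1^'n) ** (rowvector y :: real^'n^1) = outer_prod x y" for x y
    by (simp add: vec_eq_iff matrix_mult_component columnvector_def rowvector_def)
  then have centering: "centering_matrix = mat 1 - (1 / real CARD('n)) *\<^sub>R outer_prod (1 :: real^'n) (1 :: real^'n)"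
    by (simp only: centering_matrix_def)
  have one: "outer_prod (1 :: real^'n) (1 :: real^'n) *v v = (1 \<bullet> v) *\<^sub>R 1"
    by (simp add: vec_eq_iff matrix_vector_mult_def inner_vec_def)
  have "(centering_matrix :: real^'n^'n) *v v = v - ((1 \<bullet> v) / real CARD('n)) *\<^sub>R 1"
    unfolding centering matrix_vector_mult_diff_rdistrib scaleR_matrix_vector_assoc[symmetric] one by simp
  then show ?thesis
    unfolding fluctuation_def mult_outer_prod trace_outer_prod
    by (simp add: inner_diff_left power2_eq_square)
qed

theorem theorem4p4:
  fixes F :: "real^'n \<Rightarrow> real \<Rightarrow> real^'n"
    and B :: "real^'m^'n"
    and xstar :: "real \<Rightarrow> real^'n" and xc :: "real^'n"
    and \<alpha>0 \<alpha>c \<delta> :: real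
    and U :: "((real^'n) \<times> real) set"
    and M :: "real \<Rightarrow> real^'n^'n"
    and lam1 :: "real \<Rightarrow> real"
    and v w :: "real \<Rightarrow> real^'n" and vc wc :: "real^'n"
  defines "M \<equiv> drift_matrix F xstar"
  assumes N_ge_2: "CARD('n) \<ge> 2"
    and branch_interval: "\<alpha>0 < \<alpha>c"
    and branch_continuous: "continuous_on {\<alpha>0<..<\<alpha>c} xstar"
    and equilibrium: "\<And>\<alpha>. \<alpha> \<in> {\<alpha>0<..<\<alpha>c} \<Longrightarrow> F (xstar \<alpha>) \<alpha> = 0"
    and stable: "\<And>\<alpha>. \<alpha> \<in> {\<alpha>0<..<\<alpha>c} \<Longrightarrow> asymptotically_stable (\<lambda>x. F x \<alpha>) (xstar \<alpha>)"
    and branch_limit: "(xstar \<longlongrightarrow> xc) (at_left \<alpha>c)"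
    and U_open: "open U"
    and U_branch: "\<And>\<alpha>. \<alpha> \<in> {\<alpha>0<..<\<alpha>c} \<Longrightarrow> (xstar \<alpha>, \<alpha>) \<in> U"
    and U_endpoint: "(xc, \<alpha>c) \<in> U"
    and F_smooth: "C2_on (\<lambda>(x, \<alpha>). F x \<alpha>) U"
    and diag: "\<forall>\<^sub>F \<alpha> in at_left \<alpha>c. diagonalizable (complexify (M \<alpha>))"
    and spectrum_pos:
      "\<forall>\<^sub>F \<alpha> in at_left \<alpha>c. \<forall>\<mu>. is_eigenvalue (complexify (M \<alpha>)) \<mu> \<longrightarrow> Re \<mu> > 0"
    and lam1_simple:
      "\<forall>\<^sub>F \<alpha> in at_left \<alpha>c. simple_eigenvalue (complexify (M \<alpha>)) (complex_of_real (lam1 \<alpha>))"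
    and lam1_smallest:
      "\<forall>\<^sub>F \<alpha> in at_left \<alpha>c. \<forall>\<mu>. is_eigenvalue (complexify (M \<alpha>)) \<mu> \<longrightarrow> lam1 \<alpha> \<le> Re \<mu>"
    and lam1_pos: "\<forall>\<^sub>F \<alpha> in at_left \<alpha>c. lam1 \<alpha> > 0"
    and lam1_limit: "(lam1 \<longlongrightarrow> 0) (at_left \<alpha>c)"
    and delta_pos: "\<delta> > 0"
    and spectral_gap:
      "\<forall>\<^sub>F \<alpha> in at_left \<alpha>c. \<forall>\<mu>. is_eigenvalue (complexify (M \<alpha>)) \<mu> \<and>
         \<mu> \<noteq> complex_of_real (lam1 \<alpha>) \<longrightarrow> Re \<mu> \<ge> \<delta>"
    and right_eigenvector: "\<forall>\<^sub>F \<alpha> in at_left \<alpha>c. M \<alpha> *v v \<alpha> = lam1 \<alpha> *s v \<alpha>"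
    and left_eigenvector: "\<forall>\<^sub>F \<alpha> in at_left \<alpha>c. w \<alpha> v* M \<alpha> = lam1 \<alpha> *s w \<alpha>"
    and v_normalized: "\<forall>\<^sub>F \<alpha> in at_left \<alpha>c. norm (v \<alpha>) = 1"
    and w_normalized: "\<forall>\<^sub>F \<alpha> in at_left \<alpha>c. w \<alpha> \<bullet> v \<alpha> = 1"
    and v_limit: "(v \<longlongrightarrow> vc) (at_left \<alpha>c)"
    and w_limit: "(w \<longlongrightarrow> wc) (at_left \<alpha>c)"
  shows
    "(\<lambda>\<alpha>. fluctuation (stationary_cov (M \<alpha>) B) -
        (let sigma_eff_sq = w \<alpha> \<bullet> ((B ** transpose B) *v w \<alpha>);
             \<rho> = (1 \<bullet> v \<alpha>)\<^sup>2 / real CARD('n)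
         in sigma_eff_sq / (2 * lam1 \<alpha>) * ((1 - \<rho>) / (real CARD('n) - 1))))
     \<in> O[at_left \<alpha>c](\<lambda>_. 1)"
proof -
  let ?F = "at_left \<alpha>c"
  define S where "S = B ** transpose B"
  define T where "T \<alpha> = shifted_lyapunov (M \<alpha>) (v \<alpha>) (w \<alpha>)" for \<alpha>
  define s where "s \<alpha> = w \<alpha> \<bullet> (S *v w \<alpha>)" for \<alpha>
  \<comment> \<open>By linearity, the fluctuation of \<open>R \<alpha>\<close> is the error term of
    the claim as soon as \<open>v \<alpha>\<close> is a unit vector.\<close>
  define R where "R \<alpha> = stationary_cov (M \<alpha>) B - (s \<alpha> / (2 * lam1 \<alpha>)) *\<^sub>R outer_prod (v \<alpha>) (v \<alpha>)" for \<alpha>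
  have "\<forall>\<^sub>F \<alpha> in ?F. \<alpha> \<in> {\<alpha>0<..<\<alpha>c}"
    using branch_interval by (rule eventually_at_left_real)
  then have "\<forall>\<^sub>F \<alpha> in ?F. (xstar \<alpha>, \<alpha>) \<in> U"
    by eventually_elim (rule U_branch)
  from tendsto_drift_matrix[OF F_smooth this U_endpoint branch_limit]
  obtain Mc where M_lim: "(M \<longlongrightarrow> Mc) ?F"
    unfolding M_def by blast
  have nontrivial: "?F \<noteq> bot"
    by (rule trivial_limit_at_left_real)
  define Tc where "Tc = shifted_lyapunov Mc vc wc"

  \<comment> \<open>The eigenvector relations and the normalization pass to the limit, with
    eigenvalue 0, and supply what \<open>shifted_lyapunov_injective\<close> asks of
    \<open>Mc\<close>, \<open>vc\<close> and \<open>wc\<close>.\<close>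
  have "((\<lambda>\<alpha>. lam1 \<alpha> *\<^sub>R v \<alpha>) \<longlongrightarrow> 0 *\<^sub>R vc) ?F"
    by (intro tendsto_intros lam1_limit v_limit)
  moreover have "\<forall>\<^sub>F \<alpha> in ?F. lam1 \<alpha> *\<^sub>R v \<alpha> = M \<alpha> *v v \<alpha>"
    using right_eigenvector by eventually_elim (simp add: vec_eq_iff)
  ultimately have "((\<lambda>\<alpha>. M \<alpha> *v v \<alpha>) \<longlongrightarrow> 0) ?F"
    using Lim_transform_eventually by fastforce
  then have Mvc: "Mc *v vc = 0"
    using tendsto_unique[OF nontrivial tendsto_matrix_vector_mult[OF M_lim v_limit]] by blast

  have "((\<lambda>\<alpha>. lam1 \<alpha> *\<^sub>R w \<alpha>) \<longlongrightarrow> 0 *\<^sub>R wc) ?F"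
    by (intro tendsto_intros lam1_limit w_limit)
  moreover have "\<forall>\<^sub>F \<alpha> in ?F. lam1 \<alpha> *\<^sub>R w \<alpha> = transpose (M \<alpha>) *v w \<alpha>"
    using left_eigenvector by eventually_elim (simp add: vec_eq_iff)
  ultimately have "((\<lambda>\<alpha>. transpose (M \<alpha>) *v w \<alpha>) \<longlongrightarrow> 0) ?F"
    using Lim_transform_eventually by fastforce
  then have "transpose Mc *v wc = 0"
    using tendsto_unique[OF nontrivial tendsto_matrix_vector_mult[OF tendsto_transpose[OF M_lim] w_limit]]
    by blast
  then have wMc: "wc v* Mc = 0"
    by simp

  have "((\<lambda>\<alpha>. w \<alpha> \<bullet> v \<alpha>) \<longlongrightarrow> wc \<bullet> vc) ?F"
    by (intro tendsto_intros w_limit v_limit)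
  moreover have "((\<lambda>\<alpha>. w \<alpha> \<bullet> v \<alpha>) \<longlongrightarrow> 1) ?F"
    using w_normalized by (rule tendsto_eventually)
  ultimately have wvc: "wc \<bullet> vc = 1"
    using tendsto_unique[OF nontrivial] by blast

  \<comment> \<open>Diagonalizability is given only before the limit, so the limit matrix is reached
    through its determinant: for fixed z the lower bound passes to the limit by continuity of
    \<open>det\<close>.\<close>
  have spec_limit: "Re z > 0" if z: "is_eigenvalue (complexify (Mc + outer_prod vc wc)) z" for z
  proof (rule ccontr)
    assume "\<not> Re z > 0"
    then have Re_z: "Re z \<le> 0"
      by simp
    have "\<forall>\<^sub>F \<alpha> in ?F. min 1 \<delta> ^ CARD('n)
      \<le> norm (det (mat z - complexify (M \<alpha> + outer_prod (v \<alpha>) (w \<alpha>))))"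
      using diag lam1_simple lam1_pos spectral_gap right_eigenvector left_eigenvector w_normalized
    proof eventually_elim
      case (elim \<alpha>)
      define cv cw where "cv = (\<chi> i. complex_of_real (v \<alpha> $ i))" and "cw = (\<chi> i. complex_of_real (w \<alpha> $ i))"
      have "(complexify (M \<alpha>) *v cv) $ i = of_real ((M \<alpha> *v v \<alpha>) $ i)" for i
        by (simp add: matrix_vector_mult_def cv_def)
      then have 1: "complexify (M \<alpha>) *v cv = of_real (lam1 \<alpha>) *s cv"
        by (simp add: vec_eq_iff elim(5) cv_def)
      have "(cw v* complexify (M \<alpha>)) $ i = of_real ((w \<alpha> v* M \<alpha>) $ i)" for i
        by (simp add: vector_matrix_mult_def cw_def)
      then have 2: "cw v* complexify (M \<alpha>) = of_real (lam1 \<alpha>) *s cw"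
        by (simp add: vec_eq_iff elim(6) cw_def)
      have "(\<Sum>i\<in>UNIV. cw $ i * cv $ i) = of_real (w \<alpha> \<bullet> v \<alpha>)"
        by (simp add: inner_vec_def cw_def cv_def)
      then have 3: "(\<Sum>i\<in>UNIV. cw $ i * cv $ i) = 1"
        by (simp add: elim(7))
      have "complexify (M \<alpha> + outer_prod (v \<alpha>) (w \<alpha>)) = complexify (M \<alpha>) + outer_prod cv cw"
        by (simp add: vec_eq_iff cv_def cw_def)
      then show ?case
        using det_rank_one_shift_lower_bound[OF elim(1,2,3) 1 2 3 _ delta_pos Re_z] elim(4) by simp
    qed
    moreover have "((\<lambda>\<alpha>. norm (det (mat z - complexify (M \<alpha> + outer_prod (v \<alpha>) (w \<alpha>)))))
      \<longlongrightarrow> norm (det (mat z - complexify (Mc + outer_prod vc wc)))) ?F"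
      by (intro tendsto_intros M_lim v_limit w_limit)
    ultimately have "min 1 \<delta> ^ CARD('n) \<le> norm (det (mat z - complexify (Mc + outer_prod vc wc)))"
      using tendsto_lowerbound nontrivial by blast
    moreover have "min 1 \<delta> ^ CARD('n) > 0"
      using delta_pos by simp
    ultimately show False
      using is_eigenvalue_det[OF z] by simp
  qed
  have lin: "linear (T \<alpha>)" "linear Tc" for \<alpha>
    by (simp_all add: T_def Tc_def linear_shifted_lyapunov)
  have inj: "inj Tc"
    unfolding linear_injective_0[OF lin(2)]
    using shifted_lyapunov_injective[OF Mvc wMc wvc spec_limit] by (simp add: Tc_def)
  have "((\<lambda>\<alpha>. T \<alpha> X) \<longlongrightarrow> Tc X) ?F" for X
    unfolding T_def Tc_def shifted_lyapunov_def by (intro tendsto_intros M_lim v_limit w_limit)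
  from tendsto_linear_bounded_below[OF lin inj this]
  obtain m where m: "m > 0" "\<forall>\<^sub>F \<alpha> in ?F. \<forall>X. m * norm X \<le> norm (T \<alpha> X)"
    by blast

  \<comment> \<open>The factor 1 / \<open>lam1\<close> does not occur here, so convergence of v and
    w keeps \<open>G\<close> bounded.\<close>
  define G where "G \<alpha> = S - s \<alpha> *\<^sub>R outer_prod (v \<alpha>) (v \<alpha>)" for \<alpha>
  have TR: "\<forall>\<^sub>F \<alpha> in ?F. T \<alpha> (R \<alpha>) = G \<alpha>"
    using spectrum_pos lam1_pos right_eigenvector left_eigenvector w_normalized
  proof eventually_elim
    case (elim \<alpha>)
    define C where "C = stationary_cov (M \<alpha>) B"
    define V where "V = outer_prod (v \<alpha>) (v \<alpha>)"
    have C: "M \<alpha> ** C + C ** transpose (M \<alpha>) = S"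
      unfolding C_def S_def using elim(1) by (intro stationary_cov_lyapunov) blast
    have tw: "transpose (M \<alpha>) *v w \<alpha> = lam1 \<alpha> *\<^sub>R w \<alpha>"
      using elim(4) by (simp add: vec_eq_iff)
    have "w \<alpha> \<bullet> (M \<alpha> *v u) = lam1 \<alpha> * (w \<alpha> \<bullet> u)" for u
      using tw by (simp add: dot_lmul_matrix[symmetric])
    \<comment> \<open>Each of the two terms contributes \<open>lam1 \<alpha>\<close> times w . C w,
      because w is a left eigenvector.\<close>
    then have "w \<alpha> \<bullet> ((M \<alpha> ** C + C ** transpose (M \<alpha>)) *v w \<alpha>) = 2 * lam1 \<alpha> * (w \<alpha> \<bullet> (C *v w \<alpha>))"
      by (simp add: matrix_vector_mult_add_rdistrib matrix_vector_mul_assoc[symmetric] inner_add_right tw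
          matrix_vector_mult_scaleR del: transpose_matrix_vector)
    then have wCw: "w \<alpha> \<bullet> (C *v w \<alpha>) = s \<alpha> / (2 * lam1 \<alpha>)"
      using elim(2) by (simp add: C s_def)
    have vM: "v \<alpha> v* transpose (M \<alpha>) = M \<alpha> *v v \<alpha>"
      by simp
    have MV: "M \<alpha> ** V + V ** transpose (M \<alpha>) = (2 * lam1 \<alpha>) *\<^sub>R V"
      by (simp add: V_def mult_outer_prod outer_prod_mult vM elim(3)) (simp add: vec_eq_iff)
    have "V *v u = (v \<alpha> \<bullet> u) *\<^sub>R v \<alpha>" for u
      by (simp add: V_def vec_eq_iff matrix_vector_mult_def inner_vec_def sum_distrib_left mult_ac)
    then have wVw: "w \<alpha> \<bullet> (V *v w \<alpha>) = 1"
      using elim(5) by (simp add: inner_commute)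
    \<comment> \<open>The images of C and of s / (2 \<open>lam1\<close>) V under T share the
      singular term s / (2 \<open>lam1\<close>) V; it cancels in the difference and leaves S - s
      V.\<close>
    have "T \<alpha> C = S + (s \<alpha> / (2 * lam1 \<alpha>)) *\<^sub>R V"
      by (simp add: T_def shifted_lyapunov_def C wCw V_def)
    moreover have "T \<alpha> V = (2 * lam1 \<alpha>) *\<^sub>R V + V"
      by (simp add: T_def shifted_lyapunov_def MV wVw) (simp add: V_def)
    ultimately have "T \<alpha> (C - (s \<alpha> / (2 * lam1 \<alpha>)) *\<^sub>R V) = S - s \<alpha> *\<^sub>R V"
      using elim(2) by (simp add: linear_diff[OF lin(1)] linear_cmul[OF lin(1)] scaleR_add_right)
    then show ?case
      by (simp add: R_def G_def C_def V_def)
  qed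
  have "((\<lambda>\<alpha>. norm (G \<alpha>)) \<longlongrightarrow> norm (S - (wc \<bullet> (S *v wc)) *\<^sub>R outer_prod vc vc)) ?F"
    unfolding G_def s_def by (intro tendsto_intros v_limit w_limit)
  then have "\<forall>\<^sub>F \<alpha> in ?F. norm (G \<alpha>) < norm (S - (wc \<bullet> (S *v wc)) *\<^sub>R outer_prod vc vc) + 1"
    by (rule order_tendstoD) simp
  then obtain K where K: "\<forall>\<^sub>F \<alpha> in ?F. norm (G \<alpha>) < K"
    by blast
  obtain c where c: "c > 0" "\<And>X :: real^'n^'n. norm (fluctuation X) \<le> c * norm X"
    using linear_bounded_pos[OF linear_fluctuation] by blast
  show ?thesis
  \<comment> \<open>Here c bounds the functional \<open>fluctuation\<close>, K bounds
    \<open>G\<close>, and m is the lower bound of T, so that the norm of \<open>R \<alpha>\<close>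
    is at most K / m.\<close>
  proof (rule bigoI[where c = "c * (K / m)"])
    show "\<forall>\<^sub>F \<alpha> in ?F. norm (fluctuation (stationary_cov (M \<alpha>) B) -
        (let sigma_eff_sq = w \<alpha> \<bullet> ((B ** transpose B) *v w \<alpha>);
             \<rho> = (1 \<bullet> v \<alpha>)\<^sup>2 / real CARD('n)
         in sigma_eff_sq / (2 * lam1 \<alpha>) * ((1 - \<rho>) / (real CARD('n) - 1))))
      \<le> c * (K / m) * norm (1 :: real)"
      using m(2) TR K v_normalized
    proof eventually_elim
      case (elim \<alpha>)
      have "v \<alpha> \<bullet> v \<alpha> = 1"
        using elim(4) by (simp add: norm_eq_sqrt_inner)
      then have "fluctuation (stationary_cov (M \<alpha>) B) -
        (let sigma_eff_sq = w \<alpha> \<bullet> ((B ** transpose B) *v w \<alpha>);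
             \<rho> = (1 \<bullet> v \<alpha>)\<^sup>2 / real CARD('n)
         in sigma_eff_sq / (2 * lam1 \<alpha>) * ((1 - \<rho>) / (real CARD('n) - 1))) = fluctuation (R \<alpha>)"
        by (simp add: R_def linear_diff[OF linear_fluctuation] linear_cmul[OF linear_fluctuation]
            fluctuation_outer_prod Let_def s_def S_def)
      moreover have "norm (R \<alpha>) \<le> K / m"
        using elim(1)[rule_format, of "R \<alpha>"] elim(2,3) m(1) by (simp add: field_simps)
      then have "c * norm (R \<alpha>) \<le> c * (K / m)"
        using c(1) by (intro mult_left_mono) auto
      ultimately show ?case
        using c(2)[of "R \<alpha>"] by simp
    qed
  qed
qed

end
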